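(* (a) Let $X,Y$ be sets with equivalence relations $R_X,R_Y$. For any kernel $K:X\to\mathcal{D}(Y)$ and all $\mu,\nu\in\mathcal{D}(X)$, $$d_{R_Y}(K^{\dagger}\mu,K^{\dagger}\nu)\le d_{R_X}(\mu,\nu)+\operatorname{def}(K).$$ (b) Let $X_0,\dots,X_n$ be sets with equivalence relations $R_0,\dots,R_n$, and let $K_i:X_{i-1}\to\mathcal{D}(X_i)$ be kernels for $i=1,\dots,n$. For the chain $K_1;\cdots;K_n$ and all $\mu,\nu\in\mathcal{D}(X_0)$, $$d_{R_n}\bigl((K_1;\cdots;K_n)^{\dagger}\mu,(K_1;\cdots;K_n)^{\dagger}\nu\bigr)\le d_{R_0}(\mu,\nu)+\sum_{i=1}^n\operatorname{def}(K_i).$$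
   Context: For a set $X$, $\mathcal{D}(X)$ denotes the set of finitely supported probability distributions on $X$. A kernel from $X$ to $Y$ is a function $K:X\to\mathcal{D}(Y)$; its affine extension is $K^{\dagger}(\mu)(y)=\sum_x\mu(x)K(x)(y)$, and sequential composition with $L:Y\to\mathcal{D}(Z)$ is $(K;L)(x)=L^{\dagger}(K(x))$. For an equivalence relation $R_X$ on $X$ with quotient map $q_X:X\to X/R_X$, the quotient total-variation distance is $d_{R_X}(\mu,\nu)=\mathrm{TV}((q_X)_{\#}\mu,(q_X)_{\#}\nu)$, where $(q_X)_{\#}$ is pushforward and $\mathrm{TV}(\alpha,\beta)=\tfrac12\sum_u|\alpha(u)-\beta(u)|$. The compatibility defect of $K:X\to\mathcal{D}(Y)$ (relative to $R_X,R_Y$) is $\operatorname{def}(K)=\sup_{x\,R_X\,x'}d_{R_Y}(K(x),K(x'))$; the defect of $K_i$ is taken relative to $R_{i-1},R_i$. *)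

theory Defs
  imports "HOL-Probability.Probability"
begin

text \<open>
  Sets are carriers inside a type, so that chains \<open>X\<^sub>0, \<dots>, X\<^sub>n\<close> of varying length can be
  written as a family \<open>nat \<Rightarrow> 'c set\<close>. A kernel from \<open>X\<close> to \<open>Y\<close> is a function
  \<open>K \<in> X \<rightarrow> fin_dists Y\<close>; its values outside \<open>X\<close> are irrelevant.
\<close>

definition fin_dists :: "'a set \<Rightarrow> 'a pmf set" where
  "fin_dists X = {\<mu>. finite (set_pmf \<mu>) \<and> set_pmf \<mu> \<subseteq> X}"

definition affine_ext :: "('a \<Rightarrow> 'b pmf) \<Rightarrow> 'a pmf \<Rightarrow> 'b pmf" where
  "affine_ext K \<mu> = bind_pmf \<mu> K"

lemma pmf_affine_ext:
  assumes "\<mu> \<in> fin_dists X"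
  shows "pmf (affine_ext K \<mu>) y = (\<Sum>x\<in>set_pmf \<mu>. pmf \<mu> x * pmf (K x) y)"
  using assms unfolding affine_ext_def fin_dists_def pmf_bind
  by (subst integral_measure_pmf_real[where A = "set_pmf \<mu>"]) (auto simp: mult.commute)

definition kernel_comp :: "('a \<Rightarrow> 'b pmf) \<Rightarrow> ('b \<Rightarrow> 'c pmf) \<Rightarrow> 'a \<Rightarrow> 'c pmf" where
  "kernel_comp K L = (\<lambda>x. affine_ext L (K x))"

text \<open>\<open>kernel_chain K n\<close> is \<open>K\<^sub>1;\<dots>;K\<^sub>n\<close>; the empty chain is the identity (Dirac) kernel.\<close>

primrec kernel_chain :: "(nat \<Rightarrow> 'c \<Rightarrow> 'c pmf) \<Rightarrow> nat \<Rightarrow> 'c \<Rightarrow> 'c pmf" where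
  "kernel_chain K 0 = return_pmf"
| "kernel_chain K (Suc n) = kernel_comp (kernel_chain K n) (K (Suc n))"

lemma kernel_chain_1: "kernel_chain K (Suc 0) = K (Suc 0)"
  by (simp add: kernel_comp_def affine_ext_def bind_return_pmf)

definition tv_dist :: "'u pmf \<Rightarrow> 'u pmf \<Rightarrow> real" where
  "tv_dist \<alpha> \<beta> = 1/2 * (\<Sum>\<^sub>\<infinity>u. \<bar>pmf \<alpha> u - pmf \<beta> u\<bar>)"

lemma tv_dist_finite:
  assumes "finite A" "set_pmf \<alpha> \<subseteq> A" "set_pmf \<beta> \<subseteq> A"
  shows "tv_dist \<alpha> \<beta> = 1/2 * (\<Sum>u\<in>A. \<bar>pmf \<alpha> u - pmf \<beta> u\<bar>)"
proof -
  have "(\<Sum>\<^sub>\<infinity>u. \<bar>pmf \<alpha> u - pmf \<beta> u\<bar>) = (\<Sum>\<^sub>\<infinity>u\<in>A. \<bar>pmf \<alpha> u - pmf \<beta> u\<bar>)"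
    using assms(2,3) by (intro infsum_cong_neutral) (auto, metis subset_iff set_pmf_iff)
  then show ?thesis
    using assms(1) by (simp add: tv_dist_def)
qed

text \<open>The quotient map \<open>X \<rightarrow> X // R\<close> is \<^const>\<open>Equiv_Relations.proj\<close>; pushforward is \<^const>\<open>map_pmf\<close>.\<close>

definition quot_tv :: "('a \<times> 'a) set \<Rightarrow> 'a pmf \<Rightarrow> 'a pmf \<Rightarrow> real" where
  "quot_tv R \<mu> \<nu> = tv_dist (map_pmf (Equiv_Relations.proj R) \<mu>) (map_pmf (Equiv_Relations.proj R) \<nu>)"

text \<open>
  The supremum is a real one: the set is bounded, since total variation is at most 1, and it is
  nonempty unless the source set is empty. An empty source carries no distributions.
\<close>

definition defect :: "('a \<times> 'a) set \<Rightarrow> ('b \<times> 'b) set \<Rightarrow> ('a \<Rightarrow> 'b pmf) \<Rightarrow> real" where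
  "defect RX RY K = (SUP (x, x') \<in> RX. quot_tv RY (K x) (K x'))"

lemma tv_dist_le_1:
  assumes "finite (set_pmf \<alpha>)" "finite (set_pmf \<beta>)"
  shows "tv_dist \<alpha> \<beta> \<le> 1"
proof -
  let ?A = "set_pmf \<alpha> \<union> set_pmf \<beta>"
  have "(\<Sum>u\<in>?A. \<bar>pmf \<alpha> u - pmf \<beta> u\<bar>) \<le> (\<Sum>u\<in>?A. pmf \<alpha> u + pmf \<beta> u)"
    by (intro sum_mono) (smt (verit) pmf_nonneg)
  also have "\<dots> = 2"
    using assms by (simp add: sum.distrib sum_pmf_eq_1)
  finally show ?thesis
    using assms by (subst tv_dist_finite[where A = ?A]) auto
qed

lemma defect_bdd_above:
  assumes "equiv X RX" "K \<in> X \<rightarrow> fin_dists Y"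
  shows "bdd_above ((\<lambda>(x, x'). quot_tv RY (K x) (K x')) ` RX)"
proof (rule bdd_aboveI[of _ 1], clarify)
  fix x x' assume "(x, x') \<in> RX"
  then have "x \<in> X" "x' \<in> X"
    using assms(1) by (auto simp: equiv_def)
  then have "finite (set_pmf (K x))" "finite (set_pmf (K x'))"
    using assms(2) by (auto simp: fin_dists_def)
  then show "quot_tv RY (K x) (K x') \<le> 1"
    unfolding quot_tv_def by (intro tv_dist_le_1) auto
qed

end

(* Total variation is the maximum of E_alpha f - E_beta f over test functions f with values
   in [0,1]. A test function on Y / RY pulls back along K to a function g on X that varies by
   at most def K on each RX-class. Replacing g by its class-wise infimum h costs at most
   def K, and h is a [0,1]-valued test function on X / RX. Part (b) iterates this bound. *)
theory Submission
  imports Defs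
begin

abbreviation expect :: "'a pmf \<Rightarrow> ('a \<Rightarrow> real) \<Rightarrow> real" where
  "expect p f \<equiv> measure_pmf.expectation p f"

lemma expect_eq_sum:
  assumes "finite A" "set_pmf p \<subseteq> A"
  shows "expect p f = (\<Sum>u\<in>A. pmf p u * f u)"
  using assms by (subst integral_measure_pmf_real[where A = A]) (auto simp: mult.commute)

text \<open>Shifting the test function by \<open>1/2\<close> is free because the masses agree; it makes a
  \<open>[0,1]\<close>-valued \<open>f\<close> contribute at most \<open>1/2\<close> in absolute value at each point.\<close>

lemma expect_diff_eq_sum:
  assumes "finite A" "set_pmf \<alpha> \<subseteq> A" "set_pmf \<beta> \<subseteq> A"
  shows "expect \<alpha> f - expect \<beta> f = (\<Sum>u\<in>A. (pmf \<alpha> u - pmf \<beta> u) * (f u - 1/2))"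
proof -
  have "(\<Sum>u\<in>A. pmf \<alpha> u) = 1" "(\<Sum>u\<in>A. pmf \<beta> u) = 1"
    using assms by (simp_all add: sum_pmf_eq_1)
  then show ?thesis
    unfolding expect_eq_sum[OF assms(1,2)] expect_eq_sum[OF assms(1,3)]
    by (simp only: left_diff_distrib right_diff_distrib sum_subtractf flip: sum_distrib_right)
qed

text \<open>Bounding each summand by its absolute value gives the factor 1/2 of total variation. The
  range of \<open>f\<close> is constrained on the supports only, because the later test function
  \<open>h\<close> is controlled only on classes of points of \<open>X\<close>.\<close>

lemma expect_diff_le_tv_dist:
  assumes "finite (set_pmf \<alpha>)" "finite (set_pmf \<beta>)"
    and "\<And>u. u \<in> set_pmf \<alpha> \<union> set_pmf \<beta> \<Longrightarrow> f u \<in> {0..1}"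
  shows "expect \<alpha> f - expect \<beta> f \<le> tv_dist \<alpha> \<beta>"
proof -
  let ?A = "set_pmf \<alpha> \<union> set_pmf \<beta>"
  have "expect \<alpha> f - expect \<beta> f = (\<Sum>u\<in>?A. (pmf \<alpha> u - pmf \<beta> u) * (f u - 1/2))"
    using assms(1,2) by (intro expect_diff_eq_sum) auto
  also have "\<dots> \<le> (\<Sum>u\<in>?A. \<bar>pmf \<alpha> u - pmf \<beta> u\<bar> * (1/2))"
  proof (rule sum_mono)
    fix u assume "u \<in> ?A"
    then have "\<bar>f u - 1/2\<bar> \<le> 1/2"
      using assms(3)[of u] unfolding abs_le_iff by auto
    then have "\<bar>(pmf \<alpha> u - pmf \<beta> u) * (f u - 1/2)\<bar> \<le> \<bar>pmf \<alpha> u - pmf \<beta> u\<bar> * (1/2)"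
      unfolding abs_mult by (intro mult_left_mono) auto
    then show "(pmf \<alpha> u - pmf \<beta> u) * (f u - 1/2) \<le> \<bar>pmf \<alpha> u - pmf \<beta> u\<bar> * (1/2)"
      by linarith
  qed
  also have "\<dots> = tv_dist \<alpha> \<beta>"
    using assms by (subst tv_dist_finite[of ?A]) (auto simp: sum_distrib_left)
  finally show ?thesis .
qed

lemma tv_dist_attained:
  assumes "finite (set_pmf \<alpha>)" "finite (set_pmf \<beta>)"
  obtains f where "\<And>u. f u \<in> {0..1}" "tv_dist \<alpha> \<beta> = expect \<alpha> f - expect \<beta> f"
proof
  let ?A = "set_pmf \<alpha> \<union> set_pmf \<beta>"
  \<comment> \<open>The indicator of the points where \<alpha> dominates \<beta>: shifted by 1/2 it
    is half the sign of the difference, so every summand becomes half an absolute value.\<close>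
  let ?f = "\<lambda>u. if pmf \<beta> u \<le> pmf \<alpha> u then 1 else 0 :: real"
  show "?f u \<in> {0..1}" for u
    by simp
  have "expect \<alpha> ?f - expect \<beta> ?f = (\<Sum>u\<in>?A. (pmf \<alpha> u - pmf \<beta> u) * (?f u - 1/2))"
    using assms by (intro expect_diff_eq_sum) auto
  also have "\<dots> = (\<Sum>u\<in>?A. 1/2 * \<bar>pmf \<alpha> u - pmf \<beta> u\<bar>)"
    by (rule sum.cong) (auto simp: field_simps)
  also have "\<dots> = tv_dist \<alpha> \<beta>"
    using assms by (subst tv_dist_finite[of ?A]) (auto simp: sum_distrib_left)
  finally show "tv_dist \<alpha> \<beta> = expect \<alpha> ?f - expect \<beta> ?f" ..
qed

text \<open>Tower rule: it pulls a test function on the target back along the kernel.\<close>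

lemma expect_affine_ext:
  assumes "K \<in> X \<rightarrow> fin_dists Y" "\<mu> \<in> fin_dists X"
  shows "expect (affine_ext K \<mu>) f = expect \<mu> (\<lambda>x. expect (K x) f)"
  unfolding affine_ext_def using assms
  by (subst pmf_expectation_bind[of "set_pmf \<mu>"])
    (auto simp: fin_dists_def expect_eq_sum[of "set_pmf \<mu>"])

lemma affine_ext_in_fin_dists:
  assumes "K \<in> X \<rightarrow> fin_dists Y" "\<mu> \<in> fin_dists X"
  shows "affine_ext K \<mu> \<in> fin_dists Y"
  using assms by (fastforce simp: fin_dists_def affine_ext_def)

lemma affine_ext_kernel_comp:
  "affine_ext (kernel_comp K L) \<mu> = affine_ext L (affine_ext K \<mu>)"
  by (simp add: affine_ext_def kernel_comp_def bind_assoc_pmf)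

text \<open>The real supremum is a genuine upper bound here because \<open>defect_bdd_above\<close>
  supplies boundedness.\<close>

lemma quot_tv_le_defect:
  assumes "equiv X RX" "K \<in> X \<rightarrow> fin_dists Y" "(x, x') \<in> RX"
  shows "quot_tv RY (K x) (K x') \<le> defect RX RY K"
  unfolding defect_def using cSUP_upper[OF assms(3) defect_bdd_above[OF assms(1,2)]] by simp

text \<open>Finite support turns both expectations into finite sums, so comparison on the support
  suffices.\<close>

lemma expect_mono_on:
  assumes "finite (set_pmf p)" "\<And>x. x \<in> set_pmf p \<Longrightarrow> f x \<le> g x"
  shows "expect p f \<le> expect p g"
  using assms by (auto simp: expect_eq_sum[of "set_pmf p"] intro!: sum_mono mult_left_mono)

lemma quot_tv_affine_ext_le:
  assumes RX: "equiv X RX" and K: "K \<in> X \<rightarrow> fin_dists Y"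
    and \<mu>: "\<mu> \<in> fin_dists X" and \<nu>: "\<nu> \<in> fin_dists X"
  shows "quot_tv RY (affine_ext K \<mu>) (affine_ext K \<nu>) \<le> quot_tv RX \<mu> \<nu> + defect RX RY K"
proof -
  let ?q = "Equiv_Relations.proj RX" and ?r = "Equiv_Relations.proj RY"
  have fin: "finite (set_pmf \<mu>)" "finite (set_pmf \<nu>)" "set_pmf \<mu> \<subseteq> X" "set_pmf \<nu> \<subseteq> X"
    and finK: "\<And>x. x \<in> X \<Longrightarrow> finite (set_pmf (K x))"
    using \<mu> \<nu> K by (auto simp: fin_dists_def)
  have "finite (set_pmf (map_pmf ?r (affine_ext K p)))" if "p \<in> fin_dists X" for p
    using affine_ext_in_fin_dists[OF K that] by (simp add: fin_dists_def)
  then obtain f where f: "\<And>u. f u \<in> {0..1}"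
    and tv: "quot_tv RY (affine_ext K \<mu>) (affine_ext K \<nu>)
      = expect (map_pmf ?r (affine_ext K \<mu>)) f - expect (map_pmf ?r (affine_ext K \<nu>)) f"
    unfolding quot_tv_def using \<mu> \<nu> by (meson tv_dist_attained)
  define g where "g x = expect (K x) (\<lambda>y. f (?r y))" for x
  \<comment> \<open>\<open>h\<close> takes any set as argument, but is evaluated only at classes of
    points of \<open>X\<close>; these are nonempty and \<open>g\<close> is bounded below on them, so
    the real infimum is meaningful.\<close>
  define h where "h C = (INF x\<in>C. g x)" for C
  have g01: "g x \<in> {0..1}" if "x \<in> X" for x
    using expect_mono_on[OF finK[OF that], of "\<lambda>_. 0" "\<lambda>y. f (?r y)"]
      expect_mono_on[OF finK[OF that], of "\<lambda>y. f (?r y)" "\<lambda>_. 1"] f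
    by (simp add: g_def)
  have g_le: "g x \<le> g x' + defect RX RY K" if "(x, x') \<in> RX" for x x'
  proof -
    have "x \<in> X" "x' \<in> X"
      using that RX by (auto simp: equiv_def)
    \<comment> \<open>\<open>f\<close> was chosen for the two images of \<mu> and \<nu>, but being
      [0,1]-valued it also tests the pushforwards of \<open>K x\<close> and
      \<open>K x'\<close>.\<close>
    then have "g x - g x' \<le> quot_tv RY (K x) (K x')"
      using expect_diff_le_tv_dist[of "map_pmf ?r (K x)" "map_pmf ?r (K x')" f] f finK
      by (simp add: g_def quot_tv_def)
    then show ?thesis
      using quot_tv_le_defect[OF RX K that, of RY] by linarith
  qed
  have h: "h (?q x) \<le> g x" "g x \<le> h (?q x) + defect RX RY K" "h (?q x) \<in> {0..1}"
    if x: "x \<in> X" for x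
  proof -
    have cls: "x \<in> ?q x" "?q x \<subseteq> X" "\<And>x'. x' \<in> ?q x \<Longrightarrow> (x, x') \<in> RX"
      using RX x equiv_class_self[OF RX x] by (auto simp: Equiv_Relations.proj_def equiv_def)
    have bdd: "bdd_below (g ` ?q x)"
      using g01 cls(2) by (intro bdd_belowI[of _ 0]) auto
    show le: "h (?q x) \<le> g x"
      unfolding h_def using bdd cls(1) by (rule cINF_lower)
    \<comment> \<open>By \<open>g_le\<close>, the left side is a lower bound of \<open>g\<close> on
      the whole class of \<open>x\<close>.\<close>
    have "g x - defect RX RY K \<le> h (?q x)"
      unfolding h_def using cls(1) g_le[OF cls(3)]
      by (intro cINF_greatest) (auto simp: algebra_simps)
    then show "g x \<le> h (?q x) + defect RX RY K"
      by linarith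
    have "0 \<le> h (?q x)"
      unfolding h_def using cls g01 by (intro cINF_greatest) auto
    then show "h (?q x) \<in> {0..1}"
      using le g01[OF x] by auto
  qed
  have "quot_tv RY (affine_ext K \<mu>) (affine_ext K \<nu>) = expect \<mu> g - expect \<nu> g"
    using tv by (simp add: expect_affine_ext[OF K \<mu>] expect_affine_ext[OF K \<nu>] g_def[abs_def])
  \<comment> \<open>The defect is paid once: on the \<mu> side \<open>g\<close> is replaced by
    \<open>h\<close> plus the defect, while on the \<nu> side \<open>h\<close> lies below
    \<open>g\<close> and costs nothing.\<close>
  moreover have "expect \<mu> g \<le> expect \<mu> (\<lambda>x. h (?q x) + defect RX RY K)"
    using fin h(2) by (intro expect_mono_on) auto
  moreover have "\<dots> = expect \<mu> (\<lambda>x. h (?q x)) + defect RX RY K"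
    using fin by (simp add: integrable_measure_pmf_finite)
  moreover have "expect \<nu> (\<lambda>x. h (?q x)) \<le> expect \<nu> g"
    using fin h(1) by (intro expect_mono_on) auto
  moreover have "expect \<mu> (\<lambda>x. h (?q x)) - expect \<nu> (\<lambda>x. h (?q x)) \<le> quot_tv RX \<mu> \<nu>"
    using expect_diff_le_tv_dist[of "map_pmf ?q \<mu>" "map_pmf ?q \<nu>" h] fin h(3)
    by (auto simp: quot_tv_def)
  ultimately show ?thesis
    by linarith
qed

lemma kernel_chain_in_fin_dists:
  assumes "\<forall>i\<in>{1..n}. K i \<in> X (i - 1) \<rightarrow> fin_dists (X i)"
  shows "kernel_chain K n \<in> X 0 \<rightarrow> fin_dists (X n)"
  using assms
proof (induction n)
  case 0
  then show ?case
    by (simp add: fin_dists_def)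
next
  case (Suc n)
  then have "kernel_chain K n \<in> X 0 \<rightarrow> fin_dists (X n)" "K (Suc n) \<in> X n \<rightarrow> fin_dists (X (Suc n))"
    by force+
  then show ?case
    by (auto simp: kernel_comp_def intro: affine_ext_in_fin_dists)
qed

text \<open>Induction on the length: the last kernel acts on the images of \<mu> and \<nu> under the
  shorter chain, so the one-kernel bound adds exactly its own defect.\<close>

lemma quot_tv_kernel_chain_le:
  assumes "\<forall>i\<le>n. equiv (X i) (R i)"
    and "\<forall>i\<in>{1..n}. K i \<in> X (i - 1) \<rightarrow> fin_dists (X i)"
    and "\<mu> \<in> fin_dists (X 0)" "\<nu> \<in> fin_dists (X 0)"
  shows "quot_tv (R n) (affine_ext (kernel_chain K n) \<mu>) (affine_ext (kernel_chain K n) \<nu>)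
    \<le> quot_tv (R 0) \<mu> \<nu> + (\<Sum>i=1..n. defect (R (i - 1)) (R i) (K i))"
  using assms(1,2)
proof (induction n)
  case 0
  then show ?case
    by (simp add: affine_ext_def bind_return_pmf')
next
  case (Suc n)
  have chain: "kernel_chain K n \<in> X 0 \<rightarrow> fin_dists (X n)"
    using Suc.prems(2) by (intro kernel_chain_in_fin_dists) auto
  have K: "K (Suc n) \<in> X n \<rightarrow> fin_dists (X (Suc n))"
    using Suc.prems(2) by force
  have "equiv (X n) (R n)"
    using Suc.prems(1) by simp
  note step = quot_tv_affine_ext_le[OF this K affine_ext_in_fin_dists[OF chain assms(3)]
      affine_ext_in_fin_dists[OF chain assms(4)], of "R (Suc n)"]
  have "quot_tv (R n) (affine_ext (kernel_chain K n) \<mu>) (affine_ext (kernel_chain K n) \<nu>)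
    \<le> quot_tv (R 0) \<mu> \<nu> + (\<Sum>i=1..n. defect (R (i - 1)) (R i) (K i))"
    using Suc.prems by (intro Suc.IH) auto
  with step show ?case
    by (simp add: affine_ext_kernel_comp)
qed

theorem theorem7:
  shows "(\<forall>(X :: 'a set) (Y :: 'b set) RX RY K \<mu> \<nu>.
            equiv X RX \<longrightarrow> equiv Y RY \<longrightarrow> K \<in> X \<rightarrow> fin_dists Y \<longrightarrow>
            \<mu> \<in> fin_dists X \<longrightarrow> \<nu> \<in> fin_dists X \<longrightarrow>
            quot_tv RY (affine_ext K \<mu>) (affine_ext K \<nu>) \<le> quot_tv RX \<mu> \<nu> + defect RX RY K)
       \<and> (\<forall>(n :: nat) (X :: nat \<Rightarrow> 'c set) R K \<mu> \<nu>.
            (\<forall>i\<le>n. equiv (X i) (R i)) \<longrightarrow>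
            (\<forall>i\<in>{1..n}. K i \<in> X (i - 1) \<rightarrow> fin_dists (X i)) \<longrightarrow>
            \<mu> \<in> fin_dists (X 0) \<longrightarrow> \<nu> \<in> fin_dists (X 0) \<longrightarrow>
            quot_tv (R n) (affine_ext (kernel_chain K n) \<mu>) (affine_ext (kernel_chain K n) \<nu>)
              \<le> quot_tv (R 0) \<mu> \<nu> + (\<Sum>i=1..n. defect (R (i - 1)) (R i) (K i)))"
  using quot_tv_affine_ext_le quot_tv_kernel_chain_le by (intro conjI allI impI) blast+

end
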